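(* Let $p$ be a prime, $\mathbf w=(w_0,\dots,w_n)$ a vector of positive integers, $d=\gcd(w_0,\dots,w_n)$, and let $d^{(p')}$ be the prime-to-$p$ part of $d$. For $e\ge1$ set $n(e)=\#\{i\in\{0,\dots,n\}:e\mid w_i\}$. For every power $q$ of $p$, the multiplicity spectrum $(b_0,\dots,b_n)$ of the twist zeta function $Z_{\mathrm{tw}}(\mathcal P_{\mathbf w},t)$ over $\mathbb F_q$ is given by $$b_j=\sum_{\substack{e\ge1,\ p\nmid e\\ n(e)\ge j+1}}\varphi(e),\qquad 0\le j\le n.$$ In particular: (i) the spectrum depends only on $\mathbf w$ and $p$, not on $q$; (ii) $b_0\ge b_1\ge\cdots\ge b_n=d^{(p')}$; (iii) $b_j\ge1$ for all $j$, and if $d=1$ then $b_j-1=\sum_{e\ge2,\ p\nmid e,\ n(e)\ge j+1}\varphi(e)\ge0$ for all $j$.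
   Context: For a power $q$ of $p$ and $r\ge1$, $A_{\mathbf w}(q^r)$ is the number of orbits of $\mathbb F_{q^r}^\times$ on $\mathbb F_{q^r}^{n+1}\setminus\{0\}$ under $\lambda\cdot(x_0,\dots,x_n)=(\lambda^{w_0}x_0,\dots,\lambda^{w_n}x_n)$, and $Z_{\mathrm{tw}}(\mathcal P_{\mathbf w},t)=\exp\bigl(\sum_{r\ge1}A_{\mathbf w}(q^r)\,t^r/r\bigr)$. This is a rational function which can be written uniquely as a finite product $\prod_\alpha(1-\alpha t)^{-b(\alpha)}$ over distinct complex numbers $\alpha$, each of the form $\zeta q^j$ with $\zeta$ a root of unity and $0\le j\le n$, with $b(\alpha)\in\mathbb Z$. The multiplicity spectrum is $(b_0,\dots,b_n)$ with $b_j=\sum_{|\alpha|=q^j}b(\alpha)$. $\varphi$ is Euler's totient function. *)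

theory Defs
  imports
    "HOL-Algebra.Algebra"
    "HOL-Number_Theory.Number_Theory"
    "HOL-Computational_Algebra.Computational_Algebra"
begin

text \<open>
  A weight vector \<open>(w\<^sub>0, \<dots>, w\<^sub>n)\<close> is given by \<open>n\<close> and a function \<open>w\<close>, of which only the values
  at \<open>i \<le> n\<close> are used. Since a finite field is determined up to isomorphism by its order,
  any model of the field of order \<open>Q\<close> may be chosen; a finite one always has a copy on
  the naturals.
\<close>

definition finite_field :: "nat \<Rightarrow> nat ring" where
  "finite_field Q = (SOME F. field F \<and> card (carrier F) = Q)"

definition punctured_space :: "('a, 'm) ring_scheme \<Rightarrow> nat \<Rightarrow> (nat \<Rightarrow> 'a) set" where
  "punctured_space F n = ({..n} \<rightarrow>\<^sub>E carrier F) - {\<lambda>i\<in>{..n}. \<zero>\<^bsub>F\<^esub>}"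

text \<open>The outer restriction makes each map extensional, as \<^const>\<open>BijGroup\<close> requires.\<close>

definition weighted_action ::
  "('a, 'm) ring_scheme \<Rightarrow> nat \<Rightarrow> (nat \<Rightarrow> nat) \<Rightarrow> 'a \<Rightarrow> (nat \<Rightarrow> 'a) \<Rightarrow> (nat \<Rightarrow> 'a)" where
  "weighted_action F n w c =
     (\<lambda>x\<in>punctured_space F n. \<lambda>i\<in>{..n}. (c [^]\<^bsub>F\<^esub> w i) \<otimes>\<^bsub>F\<^esub> x i)"

definition orbit_count :: "nat \<Rightarrow> (nat \<Rightarrow> nat) \<Rightarrow> nat \<Rightarrow> nat" where
  "orbit_count n w Q =
     (let F = finite_field Q
      in card (orbits (units_of F) (punctured_space F n) (weighted_action F n w)))"

definition twist_zeta :: "nat \<Rightarrow> (nat \<Rightarrow> nat) \<Rightarrow> nat \<Rightarrow> complex fps" where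
  "twist_zeta n w q =
     fps_exp 1 oo
       Abs_fps (\<lambda>r. if r = 0 then 0 else of_nat (orbit_count n w (q ^ r)) / of_nat r)"

text \<open>
  \<open>b\<close> assigns to each \<open>\<alpha>\<close> its exponent in \<open>\<Prod>(1 - \<alpha>t)\<close> to the power \<open>-b(\<alpha>)\<close>, and vanishes
  exactly at the \<open>\<alpha>\<close> not occurring in the product.
\<close>

definition twist_factorization ::
  "nat \<Rightarrow> (nat \<Rightarrow> nat) \<Rightarrow> nat \<Rightarrow> (complex \<Rightarrow> int) \<Rightarrow> bool" where
  "twist_factorization n w q b \<longleftrightarrow>
     finite {\<alpha>. b \<alpha> \<noteq> 0} \<and>
     (\<forall>\<alpha>. b \<alpha> \<noteq> 0 \<longrightarrow>
        (\<exists>\<zeta> m j. m \<ge> 1 \<and> \<zeta> ^ m = 1 \<and> j \<le> n \<and> \<alpha> = \<zeta> * of_nat q ^ j)) \<and>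
     twist_zeta n w q = (\<Prod>\<alpha> | b \<alpha> \<noteq> 0. (1 - fps_const \<alpha> * fps_X) powi (- b \<alpha>))"

text \<open>For positive weights and \<open>q\<close> a prime power there is exactly one such \<open>b\<close>.\<close>

definition twist_exponent :: "nat \<Rightarrow> (nat \<Rightarrow> nat) \<Rightarrow> nat \<Rightarrow> complex \<Rightarrow> int" where
  "twist_exponent n w q = (THE b. twist_factorization n w q b)"

definition multiplicity_spectrum :: "nat \<Rightarrow> (nat \<Rightarrow> nat) \<Rightarrow> nat \<Rightarrow> nat \<Rightarrow> int" where
  "multiplicity_spectrum n w q j =
     (\<Sum>\<alpha> | twist_exponent n w q \<alpha> \<noteq> 0 \<and> cmod \<alpha> = real q ^ j. twist_exponent n w q \<alpha>)"

definition weight_count :: "nat \<Rightarrow> (nat \<Rightarrow> nat) \<Rightarrow> nat \<Rightarrow> nat" where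
  "weight_count n w e = card {i. i \<le> n \<and> e dvd w i}"

definition prime_to_part :: "nat \<Rightarrow> nat \<Rightarrow> nat" where
  "prime_to_part p d = d div p ^ multiplicity p d"

end

theory Submission
  imports Defs
begin

text \<open>
  Burnside's lemma and the cyclicity of the unit group of the field of order \<open>Q\<close> express the
  number of orbits as the sum of \<open>\<phi>(e) (1 + Q + \<dots> + Q^(n(e) - 1))\<close> over the divisors \<open>e\<close> of
  \<open>Q - 1\<close>. For \<open>Q = q^r\<close> the condition on \<open>e\<close> says that the order \<open>m\<close> of \<open>q\<close> modulo \<open>e\<close> divides
  \<open>r\<close>, and its indicator is the mean of \<open>z^r\<close> over the \<open>m\<close>-th roots of unity \<open>z\<close>. Hence the orbit
  counts are power sums of the numbers \<open>z q^j\<close> with \<open>j < n(e)\<close>, each weighted with \<open>\<phi>(e) / m\<close>, and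
  these weights are the exponents of the zeta function. The \<open>m\<close> roots on the circle of radius
  \<open>q^j\<close> that belong to \<open>e\<close> contribute \<open>\<phi>(e)\<close> to \<open>b\<^sub>j\<close>, whatever \<open>q\<close> is.
\<close>

section \<open>Exponentials of power sums\<close>

text \<open>If \<open>m\<close> does not divide \<open>r\<close>, multiplication by a primitive root
  \<open>u\<close> permutes the \<open>m\<close>-th roots of unity and scales the sum by
  \<open>u ^ r\<close>, which is not 1; so the sum vanishes.\<close>

lemma sum_roots_unity_power:
  fixes m r :: nat
  assumes "m > 0"
  shows "(\<Sum>z | z ^ m = (1::complex). z ^ r) = (if m dvd r then of_nat m else 0)"
proof (cases "m dvd r")
  case True
  then obtain k where "r = m * k" ..
  then have "(\<Sum>z | z ^ m = (1::complex). z ^ r) = (\<Sum>z | z ^ m = (1::complex). 1)"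
    by (intro sum.cong) (auto simp: power_mult)
  with True assms show ?thesis by (simp add: card_roots_unity_eq)
next
  case False
  let ?R = "{z::complex. z ^ m = 1}"
  define u where "u = cis (2 * pi / real m)"
  have um: "u ^ m = 1" using assms by (simp add: u_def DeMoivre)
  have u0: "u \<noteq> 0" by (simp add: u_def)
  define s where "s = r mod m"
  have s: "s < m" "s \<noteq> 0" using False assms by (auto simp: s_def dvd_eq_mod_eq_0)
  have "u ^ r = u ^ (m * (r div m) + s)" by (simp add: s_def)
  also have "\<dots> = u ^ s" by (simp add: power_add power_mult um)
  also have "\<dots> = cis (2 * pi * real s / real m)" by (simp add: u_def DeMoivre mult_ac)
  finally have ur: "u ^ r = cis (2 * pi * real s / real m)" .
  \<comment> \<open>Listing the \<open>m\<close>-th roots by \<open>k < m\<close> is injective, so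
    the nonzero residue \<open>s\<close> of \<open>r\<close> cannot give the root 1, which is listed
    at 0.\<close>
  have "inj_on (\<lambda>k. cis (2 * pi * real k / real m)) {..<m}"
    using bij_betw_roots_unity[OF assms] by (rule bij_betw_imp_inj_on)
  from inj_onD[OF this, of s 0] s assms have ur1: "u ^ r \<noteq> 1" by (auto simp: ur)
  have bij: "bij_betw ((*) u) ?R ?R"
    by (rule bij_betwI[where g = "(*) (inverse u)"])
       (auto simp: power_mult_distrib um power_inverse u0)
  have "(\<Sum>z\<in>?R. z ^ r) = (\<Sum>z\<in>?R. (u * z) ^ r)"
    by (rule sum.reindex_bij_betw[OF bij, symmetric])
  also have "\<dots> = u ^ r * (\<Sum>z\<in>?R. z ^ r)" by (simp add: power_mult_distrib sum_distrib_left)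
  finally have "(\<Sum>z\<in>?R. z ^ r) = 0" using ur1 by simp
  with False show ?thesis by simp
qed

text \<open>The exponential \<open>E\<close> and \<open>F\<close> solve the same linear equation Y'
  = G' Y with constant term 1, so F / E has derivative 0 and is the constant 1. An exponential can
  thus be identified by its logarithmic derivative.\<close>

lemma fps_exp_compose_unique:
  fixes G F :: "complex fps"
  assumes "G $ 0 = 0" "F $ 0 = 1" "fps_deriv F = fps_deriv G * F"
  shows "fps_exp 1 oo G = F"
proof -
  define E where "E = fps_exp 1 oo G"
  have E0: "E $ 0 = 1" by (simp add: E_def)
  have dE: "fps_deriv E = fps_deriv G * E"
    unfolding E_def using assms(1) by (simp add: fps_compose_deriv mult.commute)
  have u: "E * inverse E = 1" using E0 by (simp add: inverse_mult_eq_1')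
  have "fps_deriv (inverse E) = - fps_deriv E * (inverse E)\<^sup>2"
    using E0 by (simp add: fps_inverse_deriv)
  also have "\<dots> = - fps_deriv G * inverse E * (E * inverse E)"
    by (simp add: dE power2_eq_square algebra_simps)
  finally have dI: "fps_deriv (inverse E) = - fps_deriv G * inverse E" by (simp add: u)
  have "fps_deriv (F * inverse E) = 0" by (simp add: dI assms(3) algebra_simps)
  then obtain c where c: "F * inverse E = fps_const c" by (metis fps_deriv_eq_0_iff)
  have "(F * inverse E) $ 0 = 1" using E0 assms(2) by simp
  then have "c = 1" unfolding c by simp
  have "F = F * (E * inverse E)" by (simp only: u mult_1_right)
  also have "\<dots> = F * inverse E * E" by (simp only: mult_ac)
  also have "\<dots> = E" by (simp only: c \<open>c = 1\<close> fps_const_1_eq_1 mult_1_left)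
  finally show ?thesis by (simp only: E_def)
qed

text \<open>Logarithmic derivatives add up over a product; the multiplicative form avoids division
  by \<open>f x\<close>.\<close>

lemma fps_deriv_prod:
  fixes f g :: "'b \<Rightarrow> 'a::comm_ring_1 fps"
  assumes "\<And>x. x \<in> S \<Longrightarrow> fps_deriv (f x) = g x * f x"
  shows "fps_deriv (\<Prod>x\<in>S. f x) = (\<Sum>x\<in>S. g x) * (\<Prod>x\<in>S. f x)"
  using assms by (induction S rule: infinite_finite_induct) (simp_all add: algebra_simps)

lemma inverse_one_minus_const_fps_X_nth:
  "inverse (1 - fps_const a * fps_X) $ r = (a ^ r :: 'a::field)"
proof -
  have "(1 - fps_const a * fps_X) * Abs_fps (\<lambda>n. a ^ n) = 1"
  proof (rule fps_ext)
    fix n show "((1 - fps_const a * fps_X) * Abs_fps (\<lambda>n. a ^ n)) $ n = 1 $ n"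
      by (cases n) (simp_all add: left_diff_distrib mult.assoc)
  qed
  then have "inverse (1 - fps_const a * fps_X) = Abs_fps (\<lambda>n. a ^ n)"
    by (rule fps_inverse_unique)
  then show ?thesis by simp
qed

lemma fps_linear_powi_nth_0: "((1 - fps_const a * fps_X) powi k) $ 0 = (1 :: 'a::field)"
  by (simp add: power_int_def fps_nth_power_0)

text \<open>The logarithmic derivative of (1 - aX)^(-k) is ka / (1 - aX), a geometric series. Since
  \<open>powi\<close> turns negative exponents into powers of the inverse, powers of
  \<open>u\<close> and of \<open>v = 1 / u\<close> are differentiated separately.\<close>

lemma fps_deriv_linear_powi:
  fixes a :: "'a::field_char_0"
  shows "fps_deriv ((1 - fps_const a * fps_X) powi (- k)) =
    fps_const (of_int k * a) * inverse (1 - fps_const a * fps_X) * (1 - fps_const a * fps_X) powi (- k)"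
proof -
  define u where "u = 1 - fps_const a * fps_X"
  define v where "v = inverse u"
  have du: "fps_deriv u = - fps_const a" by (simp add: u_def)
  have uv: "u * v = 1" by (simp add: u_def v_def inverse_mult_eq_1')
  have dv: "fps_deriv v = fps_const a * v\<^sup>2"
    unfolding v_def by (subst fps_inverse_deriv) (simp_all add: du, simp add: u_def)
  show ?thesis
  proof (cases "k \<le> 0")
    case True
    obtain n where k: "k = - int n" using True by (metis minus_minus neg_0_le_iff_le nonneg_int_cases)
    have "fps_deriv (u ^ n) = fps_const (of_int k * a) * v * u ^ n"
    proof (cases n)
      case (Suc m)
      have "v * u ^ n = (u * v) * u ^ m" by (simp only: Suc power_Suc mult_ac)
      then have vu: "v * u ^ n = u ^ m" by (simp add: uv)
      have "fps_deriv (u ^ n) = fps_const (of_nat n) * (- fps_const a) * u ^ m"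
        by (simp only: fps_deriv_power du Suc diff_Suc_1)
      also have "\<dots> = fps_const (of_int k * a) * u ^ m" by (simp add: k)
      finally show ?thesis by (simp only: mult.assoc vu)
    qed (simp add: k)
    then show ?thesis unfolding u_def[symmetric] v_def[symmetric] by (simp add: k)
  next
    case False
    then obtain n where k: "k = int n" "n > 0" by (metis not_less zero_less_imp_eq_int less_eq_int_code(1) linorder_not_less)
    then obtain m where n: "n = Suc m" by (cases n) auto
    have "u powi (- k) = v ^ n"
      using k by (simp add: power_int_def v_def)
    moreover have "fps_deriv (v ^ n) = fps_const (of_int k * a) * v * v ^ n"
    proof -
      have "fps_deriv (v ^ n) = fps_const (of_nat n) * (fps_const a * v\<^sup>2) * v ^ m"
        by (simp only: fps_deriv_power dv n diff_Suc_1)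
      also have "\<dots> = (fps_const (of_nat n) * fps_const a) * v * v ^ n"
        by (simp only: n power_Suc power2_eq_square mult_ac)
      finally show ?thesis by (simp add: k)
    qed
    ultimately show ?thesis unfolding u_def[symmetric] v_def[symmetric] by simp
  qed
qed

text \<open>Differentiation removes the denominators \<open>r\<close>: it leaves the power sums of
  index \<open>r + 1\<close>, which are the coefficients of the sum of the logarithmic derivatives
  of the factors.\<close>

lemma fps_exp_power_sums:
  fixes b :: "complex \<Rightarrow> int"
  shows "fps_exp 1 oo Abs_fps (\<lambda>r. if r = 0 then 0 else (\<Sum>a\<in>S. of_int (b a) * a ^ r) / of_nat r)
    = (\<Prod>a\<in>S. (1 - fps_const a * fps_X) powi (- b a))" (is "_ oo ?G = ?P")
proof (rule fps_exp_compose_unique)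
  show "?P $ 0 = 1" 
    by (induction S rule: infinite_finite_induct) (simp_all add: fps_linear_powi_nth_0)
  have "fps_deriv ?G = (\<Sum>a\<in>S. fps_const (of_int (b a) * a) * inverse (1 - fps_const a * fps_X))"
  proof (rule fps_ext)
    fix r
    have "fps_deriv ?G $ r = (\<Sum>a\<in>S. of_int (b a) * a ^ Suc r)"
      by (simp add: field_simps del: of_nat_Suc)
    also have "\<dots> = (\<Sum>a\<in>S. fps_const (of_int (b a) * a) * inverse (1 - fps_const a * fps_X)) $ r"
      by (simp add: fps_sum_nth inverse_one_minus_const_fps_X_nth mult.assoc)
    finally show "fps_deriv ?G $ r = \<dots>" .
  qed
  then show "fps_deriv ?P = fps_deriv ?G * ?P"
    by (simp only:) (rule fps_deriv_prod, rule fps_deriv_linear_powi)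
qed simp

section \<open>Uniqueness of the exponents in a product of linear powers\<close>

text \<open>The factor at \<open>a\<close> is a nonzero multiple of X - 1/a, and no other factor
  vanishes at 1/a.\<close>

lemma order_prod_linear_powers:
  fixes n :: "'a::field \<Rightarrow> nat"
  assumes "finite A" "a \<in> A" "a \<noteq> 0"
  shows "order (inverse a) (\<Prod>c\<in>A. [:1, -c:] ^ n c) = n a"
proof -
  have "(\<Prod>c\<in>A. [:1, -c:] ^ n c) = [:1, -a:] ^ n a * (\<Prod>c\<in>A - {a}. [:1, -c:] ^ n c)"
    using assms by (simp add: prod.remove)
  also have "[:1, -a:] = smult (-a) [:- inverse a, 1:]" using assms by simp
  finally have eq: "(\<Prod>c\<in>A. [:1, -c:] ^ n c) =
      smult ((-a) ^ n a) ([:- inverse a, 1:] ^ n a * (\<Prod>c\<in>A - {a}. [:1, -c:] ^ n c))"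
    by (simp only: smult_power mult_smult_left)
  have "poly (\<Prod>c\<in>A - {a}. [:1, -c:] ^ n c) (inverse a) \<noteq> 0"
    using assms by (auto simp: poly_prod field_simps)
  then have "order (inverse a) (\<Prod>c\<in>A - {a}. [:1, -c:] ^ n c) = 0"
    by (rule order_0I)
  moreover have "(\<Prod>c\<in>A - {a}. [:1, -c:] ^ n c) \<noteq> 0" using assms(1) by auto
  ultimately show ?thesis
    unfolding eq using assms(3)
    by (subst order_smult) (simp, subst order_mult, simp, simp add: order_power_n_n)
qed

text \<open>A sufficiently large power of \<open>x\<close> clears negative exponents; products of
  linear powers become polynomials in this way.\<close>

lemma fps_powi_mult_power:
  fixes x :: "'a::field fps"
  assumes "x $ 0 \<noteq> 0" "k \<le> int N"
  shows "x powi (- k) * x ^ N = x ^ nat (int N - k)"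
proof (cases "k \<le> 0")
  case True
  then show ?thesis by (simp add: power_int_def power_add[symmetric] nat_add_distrib add.commute)
      (metis True assms(2) diff_conv_add_uminus nat_add_distrib nat_int neg_0_le_iff_le of_nat_0_le_iff add.commute)
next
  case False
  define m where "m = nat k"
  have m: "k = int m" "m \<le> N" using False assms(2) by (auto simp: m_def)
  have "x ^ N = x ^ m * x ^ (N - m)" using m by (simp add: power_add[symmetric])
  moreover have "inverse x ^ m * x ^ m = 1"
    using assms(1) by (simp add: power_mult_distrib[symmetric] inverse_mult_eq_1)
  ultimately have "inverse x ^ m * x ^ N = x ^ (N - m)" by (simp add: mult.assoc[symmetric])
  moreover have "x powi (- k) = inverse x ^ m" using False by (simp add: power_int_def m_def)
  moreover have "nat (int N - k) = N - m" using m by simp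
  ultimately show ?thesis by simp
qed

text \<open>After multiplication by a common power of all factors both sides are polynomials, and
  the order at 1/a recovers the exponent at \<open>a\<close>. The point 0 is excluded because its
  factor is 1 whatever the exponent.\<close>

lemma prod_linear_powi_inj:
  fixes b c :: "'a::field \<Rightarrow> int"
  assumes "finite A" "0 \<notin> A"
    and eq: "(\<Prod>a\<in>A. (1 - fps_const a * fps_X) powi (- b a)) =
             (\<Prod>a\<in>A. (1 - fps_const a * fps_X) powi (- c a))"
    and "a \<in> A"
  shows "b a = c a"
proof -
  \<comment> \<open>\<open>N\<close> dominates every \<open>b a\<close> and \<open>c a\<close>, so
    truncation by \<open>nat\<close> loses nothing when the exponents are compared at the
    end.\<close>
  define N where "N = (\<Sum>a\<in>A. nat \<bar>b a\<bar> + nat \<bar>c a\<bar>)"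
  have N: "b a \<le> int N" "c a \<le> int N" if "a \<in> A" for a
  proof -
    have "nat \<bar>b a\<bar> + nat \<bar>c a\<bar> \<le> N"
      unfolding N_def by (rule member_le_sum) (use that assms(1) in auto)
    then show "b a \<le> int N" "c a \<le> int N" by linarith+
  qed
  define P where "P f = (\<Prod>a\<in>A. [:1, -a:] ^ nat (int N - f a))" for f :: "'a \<Rightarrow> int"
  have P: "fps_of_poly (P f) =
      (\<Prod>a\<in>A. (1 - fps_const a * fps_X) powi (- f a)) * (\<Prod>a\<in>A. (1 - fps_const a * fps_X) ^ N)"
    if "\<And>a. a \<in> A \<Longrightarrow> f a \<le> int N" for f
  proof -
    have lin: "fps_of_poly [:1, - a:] = 1 - fps_const a * fps_X" for a :: 'a
      by (simp add: fps_of_poly_pCons mult.commute)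
    have "fps_of_poly (P f) = (\<Prod>a\<in>A. (1 - fps_const a * fps_X) ^ nat (int N - f a))"
      by (simp add: P_def fps_of_poly_prod fps_of_poly_power lin)
    also have "\<dots> = (\<Prod>a\<in>A. (1 - fps_const a * fps_X) powi (- f a) * (1 - fps_const a * fps_X) ^ N)"
      using that by (intro prod.cong refl fps_powi_mult_power[symmetric]) auto
    finally show ?thesis by (simp only: prod.distrib)
  qed
  have "fps_of_poly (P b) = fps_of_poly (P c)" using N eq by (simp add: P)
  then have "P b = P c" by (simp add: fps_of_poly_eq_iff)
  moreover have "order (inverse a) (P f) = nat (int N - f a)" for f
    unfolding P_def using assms by (intro order_prod_linear_powers) auto
  ultimately have "nat (int N - b a) = nat (int N - c a)" by metis
  with N[OF assms(4)] show ?thesis by simp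
qed

section \<open>Finite fields of prime power order\<close>

context cring begin

lemma binomial_finsum:
  assumes "x \<in> carrier R" "y \<in> carrier R"
  shows "(x \<oplus> y) [^] (n::nat) = (\<Oplus>k\<in>{..n}. [(n choose k)] \<cdot> (x [^] k \<otimes> y [^] (n - k)))"
proof (induction n)
  case 0
  show ?case using assms by simp
next
  case (Suc n)
  note [simp] = assms
  \<comment> \<open>The parameter \<open>m\<close> covers the summands of the induction hypothesis
    (\<open>m = n\<close>) and those after multiplication by \<open>y\<close>
    (\<open>m = Suc n\<close>).\<close>
  define t where "t m k = [(n choose k)] \<cdot> (x [^] k \<otimes> y [^] (m - k))" for m k
  have tc [simp]: "t m k \<in> carrier R" for m k by (simp add: t_def)
  define u where "u k = [(n choose k)] \<cdot> (x [^] (Suc k) \<otimes> y [^] (n - k))" for k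
  have uc [simp]: "u k \<in> carrier R" for k by (simp add: u_def)
  have IH: "(x \<oplus> y) [^] n = (\<Oplus>k\<in>{..n}. t n k)" unfolding t_def by (rule Suc.IH)
  have sx: "(\<Oplus>k\<in>{..n}. t n k) \<otimes> x = (\<Oplus>k\<in>{..n}. u k)"
  proof -
    have "t n k \<otimes> x = u k" for k
    proof -
      have "(x [^] k \<otimes> y [^] (n - k)) \<otimes> x = x [^] (Suc k) \<otimes> y [^] (n - k)"
        by (simp add: m_ac)
      then show ?thesis by (simp add: t_def u_def add_pow_ldistr del: nat_pow_Suc)
    qed
    then show ?thesis by (simp add: finsum_ldistr Pi_def)
  qed
  have sy: "(\<Oplus>k\<in>{..n}. t n k) \<otimes> y = (\<Oplus>k\<in>{..n}. t (Suc n) k)"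
  proof -
    have "t n k \<otimes> y = t (Suc n) k" if "k \<le> n" for k
    proof -
      have "(x [^] k \<otimes> y [^] (n - k)) \<otimes> y = x [^] k \<otimes> y [^] (Suc n - k)"
        using that by (simp add: m_assoc Suc_diff_le)
      then show ?thesis by (simp add: t_def add_pow_ldistr)
    qed
    then have "(\<Oplus>k\<in>{..n}. t n k \<otimes> y) = (\<Oplus>k\<in>{..n}. t (Suc n) k)"
      by (intro finsum_cong') (auto simp: Pi_def)
    then show ?thesis by (simp add: finsum_ldistr Pi_def)
  qed
  define v where "v k = [(Suc n choose k)] \<cdot> (x [^] k \<otimes> y [^] (Suc n - k))" for k
  have vc [simp]: "v k \<in> carrier R" for k by (simp add: v_def)
  \<comment> \<open>Pascal's rule for the binomial coefficients.\<close>
  have v_Suc: "v (Suc k) = u k \<oplus> t (Suc n) (Suc k)" for k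
    by (simp add: v_def u_def t_def add.nat_pow_mult del: nat_pow_Suc)
  have v0: "v 0 = t (Suc n) 0" by (simp add: v_def t_def)
  \<comment> \<open>As \<open>n choose Suc n\<close> is 0, the sum of the \<open>t (Suc n) k\<close>
    may run up to \<open>Suc n\<close>, the range obtained after the index shift.\<close>
  have top: "t (Suc n) (Suc n) = \<zero>" by (simp add: t_def binomial_eq_0)
  have "(\<Oplus>k\<in>{..Suc n}. v k) = (\<Oplus>k\<in>{..n}. v (Suc k)) \<oplus> v 0"
    by (rule finsum_Suc2) (simp add: Pi_def)
  also have "\<dots> = ((\<Oplus>k\<in>{..n}. u k) \<oplus> (\<Oplus>k\<in>{..n}. t (Suc n) (Suc k))) \<oplus> t (Suc n) 0"
    by (simp add: v_Suc v0 finsum_addf Pi_def)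
  also have "\<dots> = (\<Oplus>k\<in>{..n}. u k) \<oplus> ((\<Oplus>k\<in>{..n}. t (Suc n) (Suc k)) \<oplus> t (Suc n) 0)"
    by (simp add: a_assoc Pi_def)
  also have "(\<Oplus>k\<in>{..n}. t (Suc n) (Suc k)) \<oplus> t (Suc n) 0 = (\<Oplus>k\<in>{..Suc n}. t (Suc n) k)"
    by (rule finsum_Suc2[symmetric]) (simp add: Pi_def)
  also have "\<dots> = (\<Oplus>k\<in>{..n}. t (Suc n) k)"
    by (subst finsum_Suc) (simp_all add: Pi_def top)
  finally have "(\<Oplus>k\<in>{..Suc n}. v k) = (x \<oplus> y) [^] Suc n"
    by (simp add: IH r_distr sx sy Pi_def)
  then show ?case by (simp only: v_def)
qed

lemma add_pow_char_dvd:
  assumes "[p] \<cdot> \<one> = \<zero>" "p dvd (m::nat)" "z \<in> carrier R"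
  shows "[m] \<cdot> z = \<zero>"
proof -
  obtain k where "m = p * k" using assms(2) ..
  then have "[m] \<cdot> \<one> = [k] \<cdot> ([p] \<cdot> \<one>)" by (simp add: add.nat_pow_pow)
  then have "[m] \<cdot> \<one> = \<zero>" by (simp add: assms(1))
  then have "([m] \<cdot> \<one>) \<otimes> z = \<zero>" using assms(3) by simp
  then show ?thesis using assms(3) by (simp add: add_pow_ldistr)
qed

text \<open>The prime \<open>p\<close> divides \<open>p choose k\<close> for 0 < k < p, so only the
  two outer terms of the binomial expansion survive.\<close>

lemma frobenius_add:
  assumes "Factorial_Ring.prime (p::nat)" "[p] \<cdot> \<one> = \<zero>" "x \<in> carrier R" "y \<in> carrier R"
  shows "(x \<oplus> y) [^] p = x [^] p \<oplus> y [^] p"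
proof -
  note [simp] = assms(3,4)
  obtain m where p: "p = Suc m" using assms(1) by (metis not0_implies_Suc not_prime_0)
  let ?t = "\<lambda>k. [(p choose k)] \<cdot> (x [^] k \<otimes> y [^] (p - k))"
  have "?t k = (if 0 = k then y [^] p else \<zero>)" if "k \<le> m" for k
  proof (cases "k = 0")
    case False
    then have "p dvd (p choose k)" using assms(1) that by (intro dvd_choose_prime) (auto simp: p)
    then show ?thesis using add_pow_char_dvd[OF assms(2)] False by simp
  qed simp
  then have "(\<Oplus>k\<in>{..m}. ?t k) = (\<Oplus>k\<in>{..m}. if 0 = k then y [^] p else \<zero>)"
    by (intro finsum_cong') (auto simp: Pi_def)
  also have "\<dots> = y [^] p"
    using add.finprod_singleton[of 0 "{..m}" "\<lambda>_. y [^] p"] by (simp add: Pi_def)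
  finally have low: "(\<Oplus>k\<in>{..m}. ?t k) = y [^] p" .
  have "(x \<oplus> y) [^] p = (\<Oplus>k\<in>{..Suc m}. ?t k)"
    unfolding p[symmetric] by (rule binomial_finsum) simp_all
  also have "\<dots> = ?t (Suc m) \<oplus> (\<Oplus>k\<in>{..m}. ?t k)"
    by (rule finsum_Suc) (simp add: Pi_def)
  also have "?t (Suc m) = x [^] p" by (simp add: p del: nat_pow_Suc)
  finally show ?thesis by (simp add: low)
qed

lemma frobenius_power_add:
  assumes "Factorial_Ring.prime (p::nat)" "[p] \<cdot> \<one> = \<zero>" "x \<in> carrier R" "y \<in> carrier R"
  shows "(x \<oplus> y) [^] (p ^ k) = x [^] (p ^ k) \<oplus> y [^] (p ^ k)"
proof (induction k)
  case (Suc k)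
  have "(x \<oplus> y) [^] (p ^ Suc k) = ((x \<oplus> y) [^] (p ^ k)) [^] p"
    using assms by (simp add: nat_pow_pow mult.commute)
  also have "\<dots> = (x [^] (p ^ k)) [^] p \<oplus> (y [^] (p ^ k)) [^] p"
    using assms by (simp add: Suc frobenius_add)
  finally show ?case using assms by (simp add: nat_pow_pow mult.commute)
qed (use assms in simp)
end

text \<open>The value of the cofactor at \<open>a\<close> is the derivative of \<open>X^n\<close>, which decides whether \<open>a\<close> is a
  multiple root.\<close>

lemma (in domain) linear_factor_var_power:
  assumes a: "a \<in> carrier R"
  shows "\<exists>s\<in>carrier (poly_ring R).
    [\<one>, \<ominus> a] \<otimes>\<^bsub>poly_ring R\<^esub> s =
      X [^]\<^bsub>poly_ring R\<^esub> (n::nat) \<ominus>\<^bsub>poly_ring R\<^esub> poly_of_const a [^]\<^bsub>poly_ring R\<^esub> n \<and>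
    eval s a = [n] \<cdot> (a [^] (n - 1))"
proof -
  let ?P = "poly_ring R"
  interpret P: domain ?P by (rule univ_poly_is_domain[OF carrier_is_subring])
  interpret H: ring_hom_ring ?P R "\<lambda>f. eval f a"
    by (rule ring_hom_ringI2[OF P.ring_axioms ring_axioms eval_is_hom[OF carrier_is_subring a]])
  interpret C: ring_hom_ring R ?P poly_of_const
    using canonical_embedding_ring_hom[OF carrier_is_subring] by simp
  have X [simp]: "X \<in> carrier ?P" by (rule var_closed(1)[OF carrier_is_subring])
  define c where "c = poly_of_const a"
  have c [simp]: "c \<in> carrier ?P" using a by (simp add: c_def)
  have lin: "[\<one>, \<ominus> a] = X \<ominus>\<^bsub>?P\<^esub> c"
  proof -
    have "X \<ominus>\<^bsub>?P\<^esub> c = poly_add X (map (\<lambda>a. \<ominus> a) c)"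
      using univ_poly_a_inv_def'[OF carrier_is_subring c]
      by (simp add: a_minus_def univ_poly_add)
    also have "\<dots> = [\<one>, \<ominus> a]" using a by (auto simp: var_def c_def poly_of_const_def)
    finally show ?thesis by simp
  qed
  have ec: "eval c a = a" using a by (auto simp: c_def poly_of_const_def)
  have eX: "eval X a = a" by (rule eval_var[OF a])
  show ?thesis unfolding c_def[symmetric] lin
  proof (induction n)
    case 0
    show ?case by (rule bexI[of _ "\<zero>\<^bsub>?P\<^esub>"]) (simp_all add: P.minus_eq P.r_neg)
  next
    case (Suc n)
    then obtain s where s [simp]: "s \<in> carrier ?P"
      and e: "(X \<ominus>\<^bsub>?P\<^esub> c) \<otimes>\<^bsub>?P\<^esub> s = X [^]\<^bsub>?P\<^esub> n \<ominus>\<^bsub>?P\<^esub> c [^]\<^bsub>?P\<^esub> n"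
      and v: "eval s a = [n] \<cdot> (a [^] (n - 1))" by blast
    define xn cn where "xn = X [^]\<^bsub>?P\<^esub> n" and "cn = c [^]\<^bsub>?P\<^esub> n"
    have [simp]: "xn \<in> carrier ?P" "cn \<in> carrier ?P" by (simp_all add: xn_def cn_def)
    \<comment> \<open>The recursion X^(n+1) - a^(n+1) = X (X^n - a^n) + (X - a) a^n yields the next
      cofactor.\<close>
    let ?s = "X \<otimes>\<^bsub>?P\<^esub> s \<oplus>\<^bsub>?P\<^esub> cn"
    have "(X \<ominus>\<^bsub>?P\<^esub> c) \<otimes>\<^bsub>?P\<^esub> ?s =
      X \<otimes>\<^bsub>?P\<^esub> ((X \<ominus>\<^bsub>?P\<^esub> c) \<otimes>\<^bsub>?P\<^esub> s) \<oplus>\<^bsub>?P\<^esub> (X \<ominus>\<^bsub>?P\<^esub> c) \<otimes>\<^bsub>?P\<^esub> cn"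
      by (simp add: P.r_distr P.m_lcomm)
    also have "\<dots> = X \<otimes>\<^bsub>?P\<^esub> (xn \<ominus>\<^bsub>?P\<^esub> cn) \<oplus>\<^bsub>?P\<^esub> (X \<ominus>\<^bsub>?P\<^esub> c) \<otimes>\<^bsub>?P\<^esub> cn"
      by (simp only: e xn_def cn_def)
    also have "\<dots> = xn \<otimes>\<^bsub>?P\<^esub> X \<ominus>\<^bsub>?P\<^esub> cn \<otimes>\<^bsub>?P\<^esub> c"
      using X c \<open>xn \<in> carrier ?P\<close> \<open>cn \<in> carrier ?P\<close> by algebra
    finally have 1: "(X \<ominus>\<^bsub>?P\<^esub> c) \<otimes>\<^bsub>?P\<^esub> ?s = X [^]\<^bsub>?P\<^esub> Suc n \<ominus>\<^bsub>?P\<^esub> c [^]\<^bsub>?P\<^esub> Suc n"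
      by (simp add: xn_def cn_def)
    have "eval ?s a = a \<otimes> ([n] \<cdot> (a [^] (n - 1))) \<oplus> a [^] n"
      by (simp add: eX ec v cn_def H.hom_nat_pow)
    also have "a \<otimes> ([n] \<cdot> (a [^] (n - 1))) = [n] \<cdot> (a [^] n)"
    proof -
      have "a \<otimes> ([n] \<cdot> (a [^] (n - 1))) = [n] \<cdot> (a \<otimes> a [^] (n - 1))"
        using a by (simp add: add_pow_rdistr)
      then show ?thesis using a by (cases n) (simp_all add: m_comm)
    qed
    also have "\<dots> \<oplus> a [^] n = [Suc n] \<cdot> (a [^] (Suc n - 1))" using a by simp
    finally show ?case using 1 by (intro bexI[of _ ?s]) simp_all
  qed
qed

text \<open>The fixed points are the roots of X^q - X with q = p^r. This polynomial splits, so it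
  has q roots with multiplicity, and each root is simple because its cofactor takes the value -1
  there.\<close>

lemma (in algebraically_closed) card_frobenius_fixed:
  assumes p: "Factorial_Ring.prime (p::nat)" and char: "[p] \<cdot> \<one> = \<zero>" and r: "r > 0"
  shows "card {x \<in> carrier L. x [^] (p ^ r) = x} = p ^ r"
proof -
  let ?P = "poly_ring L" and ?q = "p ^ r"
  interpret P: domain ?P by (rule univ_poly_is_domain[OF carrier_is_subring])
  interpret C: ring_hom_ring L ?P poly_of_const
    using canonical_embedding_ring_hom[OF carrier_is_subring] by simp
  have X [simp]: "X \<in> carrier ?P" by (rule var_closed(1)[OF carrier_is_subring])
  have q: "?q > 1" using p r by (metis one_less_power prime_gt_1_nat)
  define f where "f = X [^]\<^bsub>?P\<^esub> ?q \<ominus>\<^bsub>?P\<^esub> X"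
  have f: "f \<in> carrier ?P" by (simp add: f_def)
  \<comment> \<open>Polynomials are coefficient lists, so the length is the degree plus one. The
    lengths q + 1 and 2 differ because q > 1, and the leading terms cannot cancel.\<close>
  have len: "length f = Suc ?q"
  proof -
    have 1: "length (X [^]\<^bsub>?P\<^esub> ?q) = Suc ?q"
      by (simp add: unitary_monom_eq_var_pow[OF carrier_is_subring, symmetric] monom_def)
    have 2: "length (\<ominus>\<^bsub>?P\<^esub> X) = 2"
      by (simp add: univ_poly_a_inv_def'[OF carrier_is_subring X]) (simp add: var_def)
    have pol: "polynomial (carrier L) (X [^]\<^bsub>?P\<^esub> ?q)" "polynomial (carrier L) (\<ominus>\<^bsub>?P\<^esub> X)"
      by (simp_all add: univ_poly_carrier)
    have ne: "length (X [^]\<^bsub>?P\<^esub> ?q) \<noteq> length (\<ominus>\<^bsub>?P\<^esub> X)" using q unfolding 1 2 by linarith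
    have "length f = max (length (X [^]\<^bsub>?P\<^esub> ?q)) (length (\<ominus>\<^bsub>?P\<^esub> X))"
      unfolding f_def a_minus_def univ_poly_add
      by (rule poly_add_length_eq[OF carrier_is_subring pol ne])
    then show ?thesis using 1 2 q by simp
  qed
  have fn: "f \<noteq> []" using len by auto
  have root: "is_root f x \<longleftrightarrow> x \<in> carrier L \<and> x [^] ?q = x" for x
  proof (cases "x \<in> carrier L")
    case True
    interpret H: ring_hom_ring ?P L "\<lambda>f. eval f x"
      by (rule ring_hom_ringI2[OF P.ring_axioms ring_axioms eval_is_hom[OF carrier_is_subring True]])
    have "eval f x = x [^] ?q \<ominus> x"
      using True by (simp add: f_def a_minus_def H.hom_nat_pow eval_var[OF True])
    then show ?thesis using True fn by (simp add: is_root_def)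
  qed (simp add: is_root_def)
  have count1: "count (roots f) a = 1" if "is_root f a" for a
  proof -
    from that root have a: "a \<in> carrier L" and aq: "a [^] ?q = a" by auto
    interpret H: ring_hom_ring ?P L "\<lambda>f. eval f a"
      by (rule ring_hom_ringI2[OF P.ring_axioms ring_axioms eval_is_hom[OF carrier_is_subring a]])
    let ?c = "poly_of_const a"
    have c [simp]: "?c \<in> carrier ?P" using a by simp
    obtain s where s [simp]: "s \<in> carrier ?P"
      and e: "[\<one>, \<ominus> a] \<otimes>\<^bsub>?P\<^esub> s = X [^]\<^bsub>?P\<^esub> ?q \<ominus>\<^bsub>?P\<^esub> ?c [^]\<^bsub>?P\<^esub> ?q"
      and v: "eval s a = [?q] \<cdot> (a [^] (?q - 1))"
      using linear_factor_var_power[OF a] by blast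
    \<comment> \<open>Exponent 1 gives \<open>t\<close> with (X - a) t = X - a. Since a^q = a, the
      difference of \<open>s\<close> and \<open>t\<close> is then the cofactor of
      \<open>f\<close>.\<close>
    obtain t where t: "t \<in> carrier ?P" and e1: "[\<one>, \<ominus> a] \<otimes>\<^bsub>?P\<^esub> t = X [^]\<^bsub>?P\<^esub> (1::nat) \<ominus>\<^bsub>?P\<^esub> ?c [^]\<^bsub>?P\<^esub> (1::nat)"
      and v1: "eval t a = [(1::nat)] \<cdot> (a [^] (1 - 1 :: nat))"
      using linear_factor_var_power[OF a] by blast
    have lin: "[\<one>, \<ominus> a] \<in> carrier ?P"
      using a by (simp add: univ_poly_carrier[symmetric] polynomial_def)
    have cq: "?c [^]\<^bsub>?P\<^esub> ?q = ?c" using a aq by (metis C.hom_nat_pow)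
    let ?g = "s \<ominus>\<^bsub>?P\<^esub> t"
    have g: "?g \<in> carrier ?P" using t by simp
    have "[\<one>, \<ominus> a] \<otimes>\<^bsub>?P\<^esub> ?g = [\<one>, \<ominus> a] \<otimes>\<^bsub>?P\<^esub> s \<ominus>\<^bsub>?P\<^esub> [\<one>, \<ominus> a] \<otimes>\<^bsub>?P\<^esub> t"
      using lin t by (simp add: P.minus_eq P.r_distr P.r_minus)
    also have "\<dots> = (X [^]\<^bsub>?P\<^esub> ?q \<ominus>\<^bsub>?P\<^esub> ?c) \<ominus>\<^bsub>?P\<^esub> (X \<ominus>\<^bsub>?P\<^esub> ?c)"
      unfolding e e1 cq by simp
    also have "\<dots> = f"
    proof -
      have "(x \<ominus>\<^bsub>?P\<^esub> c) \<ominus>\<^bsub>?P\<^esub> (y \<ominus>\<^bsub>?P\<^esub> c) = x \<ominus>\<^bsub>?P\<^esub> y"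
        if "x \<in> carrier ?P" "y \<in> carrier ?P" "c \<in> carrier ?P" for x y c
        using that by algebra
      then show ?thesis unfolding f_def by simp
    qed
    finally have fg: "f = [\<one>, \<ominus> a] \<otimes>\<^bsub>?P\<^esub> ?g" by simp
    \<comment> \<open>The value of \<open>s\<close> at \<open>a\<close> is q a^(q-1), which vanishes
      in characteristic \<open>p\<close>, and that of \<open>t\<close> is 1.\<close>
    have "p dvd ?q" using r by (simp add: dvd_power)
    then have "eval s a = \<zero>" using a char by (simp add: v add_pow_char_dvd)
    then have ge: "eval ?g a = \<ominus> \<one>" using t v1 by (simp add: a_minus_def)
    have gn: "?g \<noteq> []" using ge by (auto dest: sym)
    have "\<not> is_root ?g a" using ge by (simp add: is_root_def)
    then have "a \<notin># roots ?g" using roots_mem_iff_is_root[OF g] by simp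
    moreover have "roots f = add_mset a (roots ?g)"
      unfolding fg by (rule poly_mult_degree_one_monic_imp_same_roots[OF a g gn])
    ultimately show ?thesis by (simp add: count_eq_zero_iff)
  qed
  have set: "set_mset (roots f) = {x \<in> carrier L. x [^] ?q = x}"
    using roots_mem_iff_is_root[OF f] root by auto
  have "?q = size (roots f)" using roots_over_carrier[OF f] len by (simp add: splitted_def)
  also have "\<dots> = (\<Sum>x\<in>set_mset (roots f). 1)"
    unfolding size_multiset_overloaded_eq
    by (intro sum.cong refl count1) (use roots_mem_iff_is_root[OF f] in simp)
  finally show ?thesis by (simp add: set)
qed

lemma (in field) subfield_frobenius_fixed:
  assumes p: "Factorial_Ring.prime (p::nat)" and char: "[p] \<cdot> \<one> = \<zero>"
  shows "subfield {x \<in> carrier R. x [^] (p ^ r) = x} R" (is "subfield ?S R")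
proof -
  let ?q = "p ^ r"
  have q: "?q > 0" using p by (simp add: prime_gt_0_nat)
  have z: "\<zero> [^] ?q = \<zero>" using q by (simp add: nat_pow_zero)
  have add: "(x \<oplus> y) [^] ?q = x [^] ?q \<oplus> y [^] ?q" if "x \<in> carrier R" "y \<in> carrier R" for x y
    using frobenius_power_add[OF p char that] .
  show ?thesis
  proof (rule subfieldI')
    show "subring ?S R"
    proof (rule subringI)
      fix x assume "x \<in> ?S"
      then have x: "x \<in> carrier R" "x [^] ?q = x" by auto
      \<comment> \<open>Additivity yields the sign rule without separating even and odd
        \<open>p\<close>.\<close>
      have "\<zero> = (\<ominus> x \<oplus> x) [^] ?q" using x z by (simp add: l_neg)
      also have "\<dots> = (\<ominus> x) [^] ?q \<oplus> x" using add[of "\<ominus> x" x] x by simp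
      finally have "(\<ominus> x) [^] ?q = \<ominus> x" using x by (metis a_inv_closed minus_equality nat_pow_closed)
      then show "\<ominus> x \<in> ?S" using x by simp
    qed (auto simp: add nat_pow_distrib)
    fix x assume "x \<in> ?S - {\<zero>}"
    then have x: "x \<in> carrier R" "x [^] ?q = x" "x \<in> Units R" by (auto simp: field_Units)
    have "inv x [^] ?q \<otimes> x = inv x [^] ?q \<otimes> x [^] ?q" using x by simp
    also have "\<dots> = (inv x \<otimes> x) [^] ?q" using x by (intro nat_pow_distrib[symmetric]) auto
    finally have "inv x [^] ?q \<otimes> x = \<one>" using x by simp
    then have "inv x = inv x [^] ?q" using x by (intro inv_char) (auto simp: m_comm)
    then show "inv x \<in> ?S" using x by simp
  qed
qed

section \<open>Existence of a model on the naturals\<close>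

text \<open>The additive group has order \<open>p\<close>, so \<open>p\<close> annihilates each of
  its elements.\<close>

lemma residues_prime_char:
  assumes "Factorial_Ring.prime p"
  shows "[p] \<cdot>\<^bsub>residue_ring (int p)\<^esub> \<one>\<^bsub>residue_ring (int p)\<^esub> = \<zero>\<^bsub>residue_ring (int p)\<^esub>"
proof -
  interpret residues_prime p "residue_ring (int p)" by unfold_locales (use assms in auto)
  have "Coset.order (add_monoid (residue_ring (int p))) = p"
    by (simp add: Coset.order_def res_carrier_eq)
  then show ?thesis
    using add.pow_order_eq_1[of "\<one>\<^bsub>residue_ring (int p)\<^esub>"] by (simp add: add_pow_def)
qed

text \<open>The fixed points of x -> x^(p^r) in an algebraic closure of the residue field form the
  required field. As \<open>finite_field\<close> is a choice among models, everything known about it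
  rests on this existence.\<close>

theorem exists_finite_field:
  assumes p: "Factorial_Ring.prime p" and "r > 0"
  shows "\<exists>F :: nat ring. field F \<and> card (carrier F) = p ^ r"
proof -
  let ?K = "residue_ring (int p)"
  interpret K: residues_prime p ?K by unfold_locales (use p in auto)
  define L where "L = K.alg_closure"
  interpret L: algebraic_closure L "K.indexed_const ` carrier ?K"
    unfolding L_def by (rule K.alg_closureE)
  interpret h: ring_hom_ring ?K L K.indexed_const
    unfolding L_def using K.alg_closureE(2) L.ring_axioms
    by (intro ring_hom_ringI2) (simp_all add: L_def K.ring_axioms)
  \<comment> \<open>The embedding of the prime field carries the vanishing of \<open>p\<close> times
    1 over to \<open>L\<close>.\<close>
  have "K.indexed_const ([n] \<cdot>\<^bsub>?K\<^esub> \<one>\<^bsub>?K\<^esub>) = [n] \<cdot>\<^bsub>L\<^esub> \<one>\<^bsub>L\<^esub>" for n :: nat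
    by (induction n) simp_all
  from this[of p] have char: "[p] \<cdot>\<^bsub>L\<^esub> \<one>\<^bsub>L\<^esub> = \<zero>\<^bsub>L\<^esub>"
    using residues_prime_char[OF p] by simp
  define S where "S = {x \<in> carrier L. x [^]\<^bsub>L\<^esub> (p ^ r) = x}"
  have card: "card S = p ^ r" unfolding S_def by (rule L.card_frobenius_fixed[OF p char assms(2)])
  have "subfield S L" unfolding S_def by (rule L.subfield_frobenius_fixed[OF p char])
  then interpret S: field "L\<lparr>carrier := S\<rparr>" by (rule L.subfield_iff(2))
  have "finite S" using card p by (metis card.infinite not_prime_0 power_eq_0_iff)
  then obtain g :: "_ \<Rightarrow> nat" where g: "inj_on g S"
    using finite_imp_inj_to_nat_seg by metis
  \<comment> \<open>Transport of structure along an injection makes the carrier a set of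
    naturals.\<close>
  then have "field (image_ring g (L\<lparr>carrier := S\<rparr>))"
    by (intro S.inj_imp_image_ring_is_field) simp
  moreover have "card (carrier (image_ring g (L\<lparr>carrier := S\<rparr>))) = p ^ r"
    using g card by (simp add: image_ring_carrier card_image)
  ultimately show ?thesis by blast
qed

section \<open>Orbits of the weighted action\<close>

context field begin

lemma weighted_action_closed:
  assumes c: "c \<in> Units R" and x: "x \<in> punctured_space R n"
  shows "weighted_action R n w c x \<in> punctured_space R n"
proof -
  have xc: "x i \<in> carrier R" if "i \<le> n" for i using x that by (auto simp: punctured_space_def)
  have ck: "c [^] w i \<in> carrier R" for i using c by (simp add: Units_closed)
  have "\<exists>i\<le>n. x i \<noteq> \<zero>"
  proof (rule ccontr)
    assume "\<not> ?thesis"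
    then have "x = (\<lambda>i\<in>{..n}. \<zero>)" using x by (auto simp: punctured_space_def PiE_def extensional_def)
    with x show False by (simp add: punctured_space_def)
  qed
  then obtain i where i: "i \<le> n" "x i \<noteq> \<zero>" by blast
  have "c [^] w i \<noteq> \<zero>" using Units_pow_closed[OF c, of "w i"] by (simp add: field_Units)
  then have "c [^] w i \<otimes> x i \<noteq> \<zero>" using i xc ck by (simp add: integral_iff)
  then have "(\<lambda>i\<in>{..n}. c [^] w i \<otimes> x i) \<noteq> (\<lambda>i\<in>{..n}. \<zero>)"
    using i(1) by (auto dest!: fun_cong[of _ _ i])
  moreover have "(\<lambda>i\<in>{..n}. c [^] w i \<otimes> x i) \<in> {..n} \<rightarrow>\<^sub>E carrier R" using xc ck by (simp add: restrict_PiE_iff)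
  moreover have "weighted_action R n w c x = (\<lambda>i\<in>{..n}. c [^] w i \<otimes> x i)"
    using x by (simp add: weighted_action_def)
  ultimately show ?thesis by (simp only: punctured_space_def) blast
qed

lemma weighted_action_mult:
  assumes "c \<in> Units R" "d \<in> Units R" "x \<in> punctured_space R n"
  shows "weighted_action R n w (c \<otimes> d) x = weighted_action R n w c (weighted_action R n w d x)"
proof -
  have "x i \<in> carrier R" if "i \<le> n" for i using assms(3) that by (auto simp: punctured_space_def)
  then show ?thesis
    using assms weighted_action_closed[OF assms(2,3), of w]
    by (auto simp: weighted_action_def fun_eq_iff nat_pow_distrib m_assoc Units_closed)
qed

lemma weighted_action_one:
  assumes "x \<in> punctured_space R n"
  shows "weighted_action R n w \<one> x = x"
proof -
  have "x \<in> extensional {..n}" and "\<And>i. i \<le> n \<Longrightarrow> x i \<in> carrier R"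
    using assms by (auto simp: punctured_space_def PiE_def)
  then show ?thesis
    using assms by (auto simp: weighted_action_def fun_eq_iff extensional_def)
qed

lemma weighted_group_action: "group_action (units_of R) (punctured_space R n) (weighted_action R n w)"
proof (intro group_action.intro group_hom.intro group_hom_axioms.intro)
  let ?E = "punctured_space R n" and ?\<phi> = "weighted_action R n w"
  show "group (units_of R)" by (rule units_group)
  show "group (BijGroup ?E)" by (rule group_BijGroup)
  have Bij: "?\<phi> c \<in> Bij ?E" if c: "c \<in> Units R" for c
  proof -
    have "bij_betw (?\<phi> c) ?E ?E"
      by (rule bij_betwI[where g = "?\<phi> (inv c)"])
         (use c in \<open>auto simp: weighted_action_closed weighted_action_mult[symmetric] weighted_action_one\<close>)
    then show ?thesis by (simp add: Bij_def weighted_action_def)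
  qed
  show "?\<phi> \<in> hom (units_of R) (BijGroup ?E)"
  proof (rule homI)
    fix c d assume "c \<in> carrier (units_of R)" "d \<in> carrier (units_of R)"
    then have cd: "c \<in> Units R" "d \<in> Units R" by (simp_all add: units_of_carrier)
    have "?\<phi> (c \<otimes> d) = compose ?E (?\<phi> c) (?\<phi> d)"
    proof (rule extensionalityI)
      show "?\<phi> (c \<otimes> d) \<in> extensional ?E" by (simp add: weighted_action_def)
    qed (use cd in \<open>auto simp: compose_def weighted_action_mult\<close>)
    then show "?\<phi> (c \<otimes>\<^bsub>units_of R\<^esub> d) = ?\<phi> c \<otimes>\<^bsub>BijGroup ?E\<^esub> ?\<phi> d"
      using cd by (simp add: BijGroup_def units_of_mult Bij)
  qed (use Bij in \<open>auto simp: BijGroup_def units_of_carrier\<close>)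
qed

section \<open>Counting fixed points and orbits\<close>

text \<open>The fixed-point equation splits into coordinates: \<open>x i\<close> is free if the
  order of \<open>c\<close> divides \<open>w i\<close>, and must be 0 otherwise. The subtraction
  removes the zero vector.\<close>

lemma card_weighted_invariants:
  assumes fin: "finite (carrier R)" and c: "c \<in> Units R"
  shows "card (invariants (punctured_space R n) (weighted_action R n w) c) =
    card (carrier R) ^ weight_count n w (group.ord (Multiplicative_Group.mult_of R) c) - 1"
proof -
  interpret M: group "Multiplicative_Group.mult_of R" by (rule field_mult_group)
  have cM: "c \<in> carrier (Multiplicative_Group.mult_of R)" using c by (simp add: field_Units)
  let ?D = "\<lambda>i. if c [^] w i = \<one> then carrier R else {\<zero>}"
  have fixD: "c [^] w i \<otimes> y = y \<longleftrightarrow> y \<in> ?D i" if "y \<in> carrier R" for i y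
  proof -
    have ck: "c [^] w i \<in> carrier R" using c by (simp add: Units_closed)
    have "(c [^] w i \<ominus> \<one>) \<otimes> y = c [^] w i \<otimes> y \<ominus> y"
      using ck that by (simp add: minus_eq l_distr l_minus)
    then have "c [^] w i \<otimes> y = y \<longleftrightarrow> (c [^] w i \<ominus> \<one>) \<otimes> y = \<zero>"
      using ck that by simp
    also have "\<dots> \<longleftrightarrow> c [^] w i = \<one> \<or> y = \<zero>" using ck that by (simp add: integral_iff)
    finally show ?thesis using that by auto
  qed
  have "invariants (punctured_space R n) (weighted_action R n w) c =
      PiE {..n} ?D - {\<lambda>i\<in>{..n}. \<zero>}" (is "?I = ?J")
  proof (rule Set.set_eqI)
    fix x
    have ext: "(\<lambda>i\<in>{..n}. c [^] w i \<otimes> x i) = x \<longleftrightarrow> (\<forall>i\<le>n. c [^] w i \<otimes> x i = x i)"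
      if "x \<in> extensional {..n}"
      using that by (auto simp: fun_eq_iff extensional_def)
    have sub: "PiE {..n} ?D \<subseteq> PiE {..n} (\<lambda>_. carrier R)"
      by (rule PiE_mono) auto
    show "x \<in> ?I \<longleftrightarrow> x \<in> ?J"
    proof (cases "x \<in> punctured_space R n")
      case True
      then have x: "x \<in> extensional {..n}" "\<And>i. i \<le> n \<Longrightarrow> x i \<in> carrier R"
        "x \<noteq> (\<lambda>i\<in>{..n}. \<zero>)" by (auto simp: punctured_space_def PiE_def)
      have "x \<in> ?I \<longleftrightarrow> (\<forall>i\<le>n. c [^] w i \<otimes> x i = x i)"
        using True ext[OF x(1)] by (simp add: invariants_def weighted_action_def)
      also have "\<dots> \<longleftrightarrow> (\<forall>i\<le>n. x i \<in> ?D i)" using fixD x(2) by blast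
      also have "\<dots> \<longleftrightarrow> x \<in> ?J" using x by (simp add: PiE_iff Ball_def)
      finally show ?thesis .
    next
      case False
      then show ?thesis using sub by (auto simp: invariants_def punctured_space_def)
    qed
  qed
  moreover have "(\<lambda>i\<in>{..n}. \<zero>) \<in> PiE {..n} ?D" by simp
  ultimately have "card ?I = card (PiE {..n} ?D) - 1" by (simp add: card_Diff_singleton)
  also have "card (PiE {..n} ?D) = (\<Prod>i\<le>n. if c [^] w i = \<one> then card (carrier R) else 1)"
    by (subst card_PiE) (auto intro: prod.cong)
  also have "\<dots> = card (carrier R) ^ card ({..n} \<inter> {i. c [^] w i = \<one>})"
    by (simp add: prod.If_cases)
  also have "{..n} \<inter> {i. c [^] w i = \<one>} = {i. i \<le> n \<and> group.ord (Multiplicative_Group.mult_of R) c dvd w i}"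
    using M.pow_eq_id[OF cM] by (auto simp: Multiplicative_Group.nat_pow_mult_of)
  finally show ?thesis by (simp add: weight_count_def)
qed

text \<open>The count is known as soon as one element of order \<open>d\<close> exists; a suitable
  power of a generator of the cyclic unit group is such an element.\<close>

lemma card_ord_eq_totient:
  assumes fin: "finite (carrier R)" and d: "d dvd card (carrier R) - 1"
  shows "card {c \<in> carrier (Multiplicative_Group.mult_of R). group.ord (Multiplicative_Group.mult_of R) c = d} = totient d"
proof -
  interpret M: group "Multiplicative_Group.mult_of R" by (rule field_mult_group)
  have o: "Coset.order (Multiplicative_Group.mult_of R) = card (carrier R) - 1"
    using order_mult_of[OF fin] by (simp add: Coset.order_def)
  have finM: "finite (carrier (Multiplicative_Group.mult_of R))" using fin by simp
  have opos: "Coset.order (Multiplicative_Group.mult_of R) > 0" using finM M.order_gt_0_iff_finite by blast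
  obtain g where g: "g \<in> carrier (Multiplicative_Group.mult_of R)"
    and gen: "carrier (Multiplicative_Group.mult_of R) = {g [^] i | i::nat. i \<in> UNIV}"
    using finite_field_mult_group_has_gen[OF fin] by blast
  have og: "M.ord g = Coset.order (Multiplicative_Group.mult_of R)"
  proof -
    have "M.ord g \<noteq> 0" using M.ord_ge_1[OF finM g] by simp
    then have "generate (Multiplicative_Group.mult_of R) {g} =
        {g [^]\<^bsub>Multiplicative_Group.mult_of R\<^esub> k | k::nat. k \<in> UNIV}"
      by (rule M.generate_pow_nat[OF g])
    also have "\<dots> = carrier (Multiplicative_Group.mult_of R)"
      by (simp only: gen Multiplicative_Group.nat_pow_mult_of)
    finally have "generate (Multiplicative_Group.mult_of R) {g} = carrier (Multiplicative_Group.mult_of R)" .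
    then show ?thesis using M.generate_pow_card[OF g] by (simp add: Coset.order_def)
  qed
  obtain k where k: "Coset.order (Multiplicative_Group.mult_of R) = d * k" using d o by (metis dvdE)
  with opos have kd: "k > 0" "d > 0" by auto
  have "M.ord (g [^]\<^bsub>Multiplicative_Group.mult_of R\<^esub> k) = d"
    using kd by (simp add: M.ord_pow_gen[OF g] og k)
  moreover have "g [^]\<^bsub>Multiplicative_Group.mult_of R\<^esub> k \<in> carrier (Multiplicative_Group.mult_of R)"
    by (rule M.nat_pow_closed[OF g])
  moreover have "d dvd Coset.order (Multiplicative_Group.mult_of R)" by (simp only: k dvd_triv_left)
  ultimately have "card {c \<in> carrier (Multiplicative_Group.mult_of R). M.ord c = d} = phi' d"
    using num_elems_of_ord_eq_phi'[OF fin] by blast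
  also have "\<dots> = totient d"
    by (simp add: phi'_def totient_def totatives_def Suc_le_eq greaterThanAtMost_def conj_ac)
  finally show ?thesis .
qed

text \<open>By Burnside's lemma q - 1 times the number of orbits is the total number of fixed
  points. Units of order \<open>e\<close> contribute q^n(e) - 1 each, and the geometric sum lets q -
  1 cancel.\<close>

theorem card_weighted_orbits:
  assumes fin: "finite (carrier R)"
  shows "card (orbits (units_of R) (punctured_space R n) (weighted_action R n w)) =
    (\<Sum>e | e dvd card (carrier R) - 1. totient e * (\<Sum>j<weight_count n w e. card (carrier R) ^ j))"
proof -
  let ?q = "card (carrier R)" and ?E = "punctured_space R n"
  let ?N = "card (orbits (units_of R) ?E (weighted_action R n w))"
  interpret A: group_action "units_of R" ?E "weighted_action R n w" by (rule weighted_group_action)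
  interpret M: group "Multiplicative_Group.mult_of R" by (rule field_mult_group)
  \<comment> \<open>Burnside's lemma is applied to \<open>units_of R\<close>, while orders are
    counted in \<open>mult_of R\<close>; the two groups coincide.\<close>
  have mU: "Multiplicative_Group.mult_of R = units_of R" by (rule mult_of_is_Units)
  have finM: "finite (carrier (Multiplicative_Group.mult_of R))" using fin by simp
  have o: "Coset.order (Multiplicative_Group.mult_of R) = ?q - 1"
    using order_mult_of[OF fin] by (simp add: Coset.order_def)
  have q: "?q - 1 > 0" using o finM M.order_gt_0_iff_finite by metis
  have finE: "finite ?E" using fin by (auto simp: punctured_space_def intro: finite_PiE)
  let ?f = "\<lambda>e. ?q ^ weight_count n w e - 1"
  have geo: "?f e = (?q - 1) * (\<Sum>j<weight_count n w e. ?q ^ j)" for e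
  proof -
    \<comment> \<open>The geometric sum is evaluated over the integers, where subtraction is not
      truncated.\<close>
    have "int (?f e) = int ((?q - 1) * (\<Sum>j<weight_count n w e. ?q ^ j))"
      using power_diff_1_eq[of "int ?q" "weight_count n w e"] q by (simp add: of_nat_diff)
    then show ?thesis by (simp only: of_nat_eq_iff)
  qed
  have "?N * (?q - 1) = (\<Sum>c\<in>carrier (units_of R). card (invariants ?E (weighted_action R n w) c))"
    using A.burnside finE finM by (simp only: mU[symmetric] o)
  also have "\<dots> = (\<Sum>c\<in>carrier (Multiplicative_Group.mult_of R). ?f (M.ord c))"
    unfolding mU[symmetric] by (intro sum.cong refl card_weighted_invariants[OF fin]) (simp add: field_Units)
  also have "\<dots> = (\<Sum>e | e dvd ?q - 1. \<Sum>c | c \<in> carrier (Multiplicative_Group.mult_of R) \<and> M.ord c = e. ?f (M.ord c))"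
    using finM q M.ord_dvd_group_order o by (intro sum.group[symmetric]) (auto simp del: Multiplicative_Group.carrier_mult_of)
  also have "\<dots> = (\<Sum>e | e dvd ?q - 1. totient e * ?f e)"
    using card_ord_eq_totient[OF fin] by (intro sum.cong) auto
  also have "\<dots> = (\<Sum>e | e dvd ?q - 1. totient e * (\<Sum>j<weight_count n w e. ?q ^ j) * (?q - 1))"
    unfolding geo by (intro sum.cong refl) (simp only: mult_ac)
  also have "\<dots> = (\<Sum>e | e dvd ?q - 1. totient e * (\<Sum>j<weight_count n w e. ?q ^ j)) * (?q - 1)"
    by (rule sum_distrib_right[symmetric])
  finally show ?thesis using q by simp
qed
end

section \<open>The multiplicity spectrum\<close>

text \<open>Existence justifies the choice in \<open>finite_field\<close>, and the orbit formula
  involves only the order of the chosen field.\<close>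

lemma orbit_count_prime_power:
  assumes p: "Factorial_Ring.prime p" and r: "r > 0"
  shows "orbit_count n w (p ^ r) =
    (\<Sum>e | e dvd p ^ r - 1. totient e * (\<Sum>j<weight_count n w e. (p ^ r) ^ j))"
proof -
  define F where "F = finite_field (p ^ r)"
  have F: "field F" "card (carrier F) = p ^ r"
    unfolding F_def finite_field_def using someI_ex[OF exists_finite_field[OF p r]] by simp_all
  moreover have "finite (carrier F)"
    using F(2) p by (metis card.infinite not_prime_0 power_eq_0_iff)
  ultimately show ?thesis
    using field.card_weighted_orbits[of F n w] by (simp add: orbit_count_def F_def[symmetric])
qed

text \<open>Every such \<open>e\<close> divides one of the positive weights. This makes the sums
  over \<open>e\<close> finite.\<close>

lemma finite_weight_count_pos:
  assumes "\<And>i. i \<le> n \<Longrightarrow> w i > 0"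
  shows "finite {e. weight_count n w e \<ge> 1}"
proof (rule finite_subset)
  show "{e. weight_count n w e \<ge> 1} \<subseteq> (\<Union>i\<le>n. {e. e dvd w i})"
  proof
    fix e assume "e \<in> {e. weight_count n w e \<ge> 1}"
    then have "{i. i \<le> n \<and> e dvd w i} \<noteq> {}"
      by (metis card.empty mem_Collect_eq not_one_le_zero weight_count_def)
    then show "e \<in> (\<Union>i\<le>n. {e. e dvd w i})" by blast
  qed
  show "finite (\<Union>i\<le>n. {e. e dvd w i})" using assms by auto
qed

lemma weight_count_le: "weight_count n w e \<le> Suc n"
proof -
  have "card {i. i \<le> n \<and> e dvd w i} \<le> card {..n}" by (intro card_mono) auto
  then show ?thesis by (simp add: weight_count_def)
qed

section \<open>The exponents over a fixed ground field\<close>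

locale weighted_zeta =
  fixes p n q k :: nat and w :: "nat \<Rightarrow> nat"
  assumes p: "Factorial_Ring.prime p" and w: "\<And>i. i \<le> n \<Longrightarrow> w i > 0"
    and k: "k \<ge> 1" and q: "q = p ^ k"
begin

text \<open>Only these \<open>e\<close> can contribute: divisors of q^r - 1 are prime to
  \<open>p\<close>, and a weight count of 0 gives an empty geometric sum.\<close>

definition weight_divisors :: "nat set" where "weight_divisors = {e. e \<ge> 1 \<and> \<not> p dvd e \<and> weight_count n w e \<ge> 1}"

abbreviation N :: "nat \<Rightarrow> nat" where "N \<equiv> weight_count n w"

text \<open>For \<open>e\<close> prime to \<open>q\<close> this is the degree, over the field of
  order \<open>q\<close>, of the extension generated by a primitive \<open>e\<close>-th root of
  unity.\<close>

definition frob_order :: "nat \<Rightarrow> nat" where "frob_order e = ord e q"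

text \<open>For \<open>e\<close> in \<open>weight_divisors\<close> the division is exact and counts
  the orbits of the \<open>q\<close>-Frobenius on the primitive \<open>e\<close>-th roots of
  unity.\<close>

definition orbit_mult :: "nat \<Rightarrow> nat" where "orbit_mult e = totient e div frob_order e"

text \<open>The sets of roots for different \<open>e\<close> overlap, for instance in q^j itself, so
  their contributions are added pointwise.\<close>

definition zeta_exponent :: "complex \<Rightarrow> int" where
  "zeta_exponent a = (\<Sum>e\<in>weight_divisors. \<Sum>j<N e. if (a / of_nat q ^ j) ^ frob_order e = 1 then int (orbit_mult e) else 0)"

definition zeta_roots :: "nat \<Rightarrow> nat \<Rightarrow> complex set" where "zeta_roots e j = {a. (a / of_nat q ^ j) ^ frob_order e = 1}"

definition zeta_support :: "complex set" where "zeta_support = (\<Union>e\<in>weight_divisors. \<Union>j<N e. zeta_roots e j)"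

lemma q_gt_1: "q > 1"
  unfolding q using prime_gt_1_nat[OF p] k by (intro one_less_power) auto

lemma finite_weight_divisors: "finite weight_divisors"
  by (rule finite_subset[OF _ finite_weight_count_pos[OF w]]) (auto simp: weight_divisors_def)

lemma coprime_weight_divisors: "e \<in> weight_divisors \<Longrightarrow> coprime e q"
  using prime_imp_coprime[OF p, of e] by (simp add: weight_divisors_def q coprime_commute)

lemma frob_order_pos: "e \<in> weight_divisors \<Longrightarrow> frob_order e > 0"
  using coprime_weight_divisors by (simp add: frob_order_def)

lemma orbit_mult_frob_order: "e \<in> weight_divisors \<Longrightarrow> orbit_mult e * frob_order e = totient e"
  using order_divides_totient[of e q] coprime_weight_divisors by (simp add: orbit_mult_def frob_order_def)

lemma zeta_roots_image: "zeta_roots e j = (\<lambda>z. z * of_nat q ^ j) ` {z. z ^ frob_order e = 1}"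
proof (intro equalityI subsetI)
  fix a assume "a \<in> zeta_roots e j"
  then show "a \<in> (\<lambda>z. z * of_nat q ^ j) ` {z. z ^ frob_order e = 1}"
    using q_gt_1 by (intro image_eqI[of _ _ "a / of_nat q ^ j"]) (auto simp: zeta_roots_def)
qed (use q_gt_1 in \<open>auto simp: zeta_roots_def\<close>)

lemma sum_zeta_roots: "(\<Sum>a\<in>zeta_roots e j. f a) = (\<Sum>z | z ^ frob_order e = 1. f (z * of_nat q ^ j))"
  unfolding zeta_roots_image using q_gt_1 by (subst sum.reindex) (auto simp: inj_on_def)

lemma finite_zeta_roots: "e \<in> weight_divisors \<Longrightarrow> finite (zeta_roots e j)"
  unfolding zeta_roots_image using frob_order_pos by (intro finite_imageI finite_roots_unity) (simp add: Suc_le_eq)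

lemma finite_zeta_support: "finite zeta_support"
  using finite_weight_divisors finite_zeta_roots by (auto simp: zeta_support_def)

lemma norm_zeta_roots: "e \<in> weight_divisors \<Longrightarrow> a \<in> zeta_roots e j \<Longrightarrow> cmod a = real q ^ j"
proof -
  assume "e \<in> weight_divisors" "a \<in> zeta_roots e j"
  then obtain z where "z ^ frob_order e = 1" "a = z * of_nat q ^ j" and "frob_order e > 0"
    using frob_order_pos by (auto simp: zeta_roots_image)
  then show ?thesis using power_eq_1_iff[of z "frob_order e"] by (auto simp: norm_mult norm_power)
qed

lemma zeta_exponent_support: "zeta_exponent a \<noteq> 0 \<Longrightarrow> a \<in> zeta_support"
proof (rule ccontr)
  assume "a \<notin> zeta_support"
  then have "zeta_exponent a = 0" by (auto simp: zeta_exponent_def zeta_support_def zeta_roots_def intro!: sum.neutral)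
  moreover assume "zeta_exponent a \<noteq> 0"
  ultimately show False by simp
qed

text \<open>An exchange of summations, used twice: with the powers a^r over the whole support for
  the orbit counts, and with the constant 1 over a circle for the spectrum.\<close>

lemma sum_zeta_exponent:
  fixes f :: "complex \<Rightarrow> 'a::comm_ring_1"
  assumes "T \<subseteq> zeta_support"
  shows "(\<Sum>a\<in>T. of_int (zeta_exponent a) * f a) = (\<Sum>e\<in>weight_divisors. \<Sum>j<N e. of_nat (orbit_mult e) * (\<Sum>a\<in>T \<inter> zeta_roots e j. f a))"
proof -
  have T: "finite T" using assms finite_zeta_support finite_subset by blast
  have "(\<Sum>a\<in>T. of_int (zeta_exponent a) * f a) =
      (\<Sum>a\<in>T. \<Sum>e\<in>weight_divisors. \<Sum>j<N e. if a \<in> zeta_roots e j then of_nat (orbit_mult e) * f a else 0)"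
    by (auto simp: zeta_exponent_def zeta_roots_def sum_distrib_right intro!: sum.cong)
  also have "\<dots> = (\<Sum>e\<in>weight_divisors. \<Sum>a\<in>T. \<Sum>j<N e. if a \<in> zeta_roots e j then of_nat (orbit_mult e) * f a else 0)"
    by (rule sum.swap)
  also have "\<dots> = (\<Sum>e\<in>weight_divisors. \<Sum>j<N e. \<Sum>a\<in>T. if a \<in> zeta_roots e j then of_nat (orbit_mult e) * f a else 0)"
    by (intro sum.cong refl sum.swap)
  also have "\<dots> = (\<Sum>e\<in>weight_divisors. \<Sum>j<N e. of_nat (orbit_mult e) * (\<Sum>a\<in>T \<inter> zeta_roots e j. f a))"
    using T by (simp add: sum.inter_restrict sum_distrib_left if_distrib cong: if_cong)
  finally show ?thesis .
qed

text \<open>The divisors \<open>e\<close> of q^r - 1 are those with \<open>frob_order e\<close>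
  dividing \<open>r\<close>, and this condition becomes a power sum over roots of unity.\<close>

lemma orbit_count_eq:
  assumes r: "r > 0"
  shows "of_nat (orbit_count n w (q ^ r)) = (\<Sum>a\<in>zeta_support. of_int (zeta_exponent a) * a ^ r :: complex)"
proof -
  have qr: "q ^ r > 1" using q_gt_1 r by (intro one_less_power) auto
  have dvd_iff: "e dvd q ^ r - 1 \<longleftrightarrow> frob_order e dvd r" for e
  proof -
    have "e dvd q ^ r - 1 \<longleftrightarrow> [q ^ r = 1] (mod e)" using qr by (simp add: cong_altdef_nat)
    then show ?thesis by (simp add: ord_divides' frob_order_def)
  qed
  \<comment> \<open>Otherwise \<open>p\<close> would divide the consecutive numbers q^r - 1 and
    q^r.\<close>
  have notp: "\<not> p dvd e" if "e dvd q ^ r - 1" for e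
  proof
    assume "p dvd e"
    then have "p dvd q ^ r - 1" using that by (rule dvd_trans)
    moreover have "p dvd q ^ r" using k r by (simp add: q dvd_power flip: power_mult)
    ultimately have "p dvd q ^ r - (q ^ r - 1)" by (rule dvd_diff_nat[rotated])
    then show False using qr p by simp
  qed
  have "orbit_count n w (q ^ r) = (\<Sum>e | e dvd q ^ r - 1. totient e * (\<Sum>j<N e. (q ^ r) ^ j))"
    using orbit_count_prime_power[OF p, of "k * r" n w] k r by (simp add: q power_mult)
  also have "\<dots> = (\<Sum>e\<in>weight_divisors. if frob_order e dvd r then totient e * (\<Sum>j<N e. (q ^ r) ^ j) else 0)"
  \<comment> \<open>Divisors outside \<open>weight_divisors\<close> have \<open>N e = 0\<close>;
    members that do not divide q^r - 1 are silenced by the condition.\<close>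
  proof (rule sum.mono_neutral_cong)
    show "finite {e. e dvd q ^ r - 1}" using qr by simp
    show "totient e * (\<Sum>j<N e. (q ^ r) ^ j) = 0" if "e \<in> {e. e dvd q ^ r - 1} - weight_divisors" for e
    proof -
      have "e \<noteq> 0" using that qr by (intro notI) simp
      then have "N e = 0" using that notp[of e] by (simp add: weight_divisors_def Suc_le_eq)
      then show ?thesis by simp
    qed
  qed (use finite_weight_divisors dvd_iff in auto)
  \<comment> \<open>The factor \<open>frob_order e\<close> of the totient stays with the condition:
    together they are the sum of z^r over the roots of unity of that exponent.\<close>
  also have "\<dots> = (\<Sum>e\<in>weight_divisors. \<Sum>j<N e. orbit_mult e * (if frob_order e dvd r then frob_order e * (q ^ j) ^ r else 0))"
  proof (intro sum.cong refl)
    fix e assume "e \<in> weight_divisors"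
    have "(q ^ r) ^ j = (q ^ j) ^ r" for j by (simp add: power_mult[symmetric] mult.commute)
    then show "(if frob_order e dvd r then totient e * (\<Sum>j<N e. (q ^ r) ^ j) else 0) =
        (\<Sum>j<N e. orbit_mult e * (if frob_order e dvd r then frob_order e * (q ^ j) ^ r else 0))"
      by (simp add: orbit_mult_frob_order[OF \<open>e \<in> weight_divisors\<close>, symmetric] sum_distrib_left mult.assoc)
  qed
  finally have "of_nat (orbit_count n w (q ^ r)) =
      (\<Sum>e\<in>weight_divisors. \<Sum>j<N e. of_nat (orbit_mult e) * (if frob_order e dvd r then of_nat (frob_order e) * (of_nat q ^ j) ^ r else 0 :: complex))"
    by (simp add: if_distrib[of of_nat] cong: if_cong)
  also have "\<dots> = (\<Sum>e\<in>weight_divisors. \<Sum>j<N e. of_nat (orbit_mult e) * (\<Sum>a\<in>zeta_support \<inter> zeta_roots e j. a ^ r))"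
  proof (intro sum.cong refl, goal_cases)
    case (1 e j)
    have "zeta_support \<inter> zeta_roots e j = zeta_roots e j" using 1 by (auto simp: zeta_support_def)
    then have "(\<Sum>a\<in>zeta_support \<inter> zeta_roots e j. a ^ r) = (\<Sum>z | z ^ frob_order e = 1. z ^ r) * (of_nat q ^ j) ^ r"
      by (simp add: sum_zeta_roots power_mult_distrib sum_distrib_right)
    then show ?case using sum_roots_unity_power[OF frob_order_pos, of e r] 1 by simp
  qed
  also have "\<dots> = (\<Sum>a\<in>zeta_support. of_int (zeta_exponent a) * a ^ r)" by (rule sum_zeta_exponent[symmetric]) simp
  finally show ?thesis .
qed

lemma twist_factorization_zeta_exponent: "twist_factorization n w q zeta_exponent"
  unfolding twist_factorization_def
proof (intro conjI allI impI)
  have sub: "{a. zeta_exponent a \<noteq> 0} \<subseteq> zeta_support" using zeta_exponent_support by blast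
  then show "finite {a. zeta_exponent a \<noteq> 0}" using finite_zeta_support finite_subset by blast
  show "\<exists>\<zeta> m j. m \<ge> 1 \<and> \<zeta> ^ m = 1 \<and> j \<le> n \<and> a = \<zeta> * of_nat q ^ j" if nz: "zeta_exponent a \<noteq> 0" for a
  proof -
    from zeta_exponent_support[OF nz] obtain e j where e: "e \<in> weight_divisors" "j < N e" "a \<in> zeta_roots e j" by (auto simp: zeta_support_def)
    then obtain z where "z ^ frob_order e = 1" "a = z * of_nat q ^ j" by (auto simp: zeta_roots_image)
    moreover have "j \<le> n" using e(2) weight_count_le[of n w e] by simp
    moreover have "frob_order e \<ge> 1" using frob_order_pos[OF e(1)] by simp
    ultimately show ?thesis by blast
  qed
  have "(\<lambda>r. if r = 0 then 0 else of_nat (orbit_count n w (q ^ r)) / of_nat r) =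
      (\<lambda>r. if r = 0 then 0 else (\<Sum>a\<in>zeta_support. of_int (zeta_exponent a) * a ^ r) / of_nat r :: complex)"
    using orbit_count_eq by auto
  then have "twist_zeta n w q = (\<Prod>a\<in>zeta_support. (1 - fps_const a * fps_X) powi (- zeta_exponent a))"
    unfolding twist_zeta_def using fps_exp_power_sums[of zeta_exponent zeta_support] by (simp only:)
  also have "\<dots> = (\<Prod>a | zeta_exponent a \<noteq> 0. (1 - fps_const a * fps_X) powi (- zeta_exponent a))"
    using sub finite_zeta_support by (intro prod.mono_neutral_right) auto
  finally show "twist_zeta n w q = \<dots>" .
qed

text \<open>Both products are extended by trivial factors to the union of the supports, where
  \<open>prod_linear_powi_inj\<close> applies. Uniqueness is what gives the \<open>THE\<close> in
  \<open>twist_exponent\<close> its value.\<close>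

lemma twist_factorization_unique:
  assumes f: "twist_factorization n w q f" and g: "twist_factorization n w q g"
  shows "f = g"
proof
  fix a
  define A where "A = {a. f a \<noteq> 0} \<union> {a. g a \<noteq> 0}"
  have fin: "finite A" using f g by (simp add: A_def twist_factorization_def)
  \<comment> \<open>A root of unity times a power of \<open>q\<close> is never 0.\<close>
  have "h 0 = 0" if h: "twist_factorization n w q h" for h
  proof (rule ccontr)
    assume "h 0 \<noteq> 0"
    moreover have "\<forall>a. h a \<noteq> 0 \<longrightarrow>
        (\<exists>\<zeta> m j. m \<ge> 1 \<and> \<zeta> ^ m = 1 \<and> j \<le> n \<and> a = \<zeta> * of_nat q ^ j)"
      using h unfolding twist_factorization_def by (elim conjE)
    ultimately obtain \<zeta> :: complex and m j :: nat
      where "m \<ge> 1" "\<zeta> ^ m = 1" "0 = \<zeta> * of_nat q ^ j" by metis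
    then show False using q_gt_1 by (simp add: power_0_left)
  qed
  with f g have zero: "0 \<notin> A" by (auto simp: A_def)
  have "twist_zeta n w q = (\<Prod>a\<in>A. (1 - fps_const a * fps_X) powi (- h a))"
    if "twist_factorization n w q h" "{a. h a \<noteq> 0} \<subseteq> A" for h
  proof -
    have "(\<Prod>a | h a \<noteq> 0. (1 - fps_const a * fps_X) powi (- h a)) =
        (\<Prod>a\<in>A. (1 - fps_const a * fps_X) powi (- h a))"
      using fin that(2) by (intro prod.mono_neutral_left) auto
    with that(1) show ?thesis by (simp add: twist_factorization_def)
  qed
  from this[OF f] this[OF g] have "a \<in> A \<Longrightarrow> f a = g a"
    by (intro prod_linear_powi_inj[OF fin zero]) (auto simp: A_def)
  then show "f a = g a" by (cases "a \<in> A") (simp, simp add: A_def)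
qed

lemma twist_exponent_eq: "twist_exponent n w q = zeta_exponent"
  unfolding twist_exponent_def
  using twist_factorization_zeta_exponent twist_factorization_unique by (intro the_equality) auto

text \<open>On the circle of radius q^j each \<open>e\<close> with j < n(e) has
  \<open>frob_order e\<close> roots of weight \<open>orbit_mult e\<close>. The product is the
  totient of \<open>e\<close>, from which \<open>q\<close> has disappeared.\<close>

lemma multiplicity_spectrum_eq:
  "multiplicity_spectrum n w q j =
     (\<Sum>e | e \<ge> 1 \<and> \<not> p dvd e \<and> weight_count n w e \<ge> j + 1. int (totient e))"
proof -
  define T where "T = {a \<in> zeta_support. cmod a = real q ^ j}"
  \<comment> \<open>As q > 1, circles for different indices have different radii.\<close>
  have inter: "T \<inter> zeta_roots e i = (if i = j then zeta_roots e j else {})" if "e \<in> weight_divisors" "i < N e" for e i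
  proof -
    have "cmod a = real q ^ i" if "a \<in> zeta_roots e i" for a using norm_zeta_roots \<open>e \<in> weight_divisors\<close> that .
    moreover have "real q ^ i = real q ^ j \<longleftrightarrow> i = j" using q_gt_1 by simp
    moreover have "zeta_roots e i \<subseteq> zeta_support" using that by (auto simp: zeta_support_def)
    ultimately show ?thesis by (auto simp: T_def)
  qed
  have card_roots: "card (zeta_roots e j) = frob_order e" if "e \<in> weight_divisors" for e
    using sum_zeta_roots[of "\<lambda>_. 1::nat" e j] frob_order_pos[OF that] by (simp add: card_roots_unity_eq)
  have "multiplicity_spectrum n w q j = (\<Sum>a\<in>T. zeta_exponent a)"
    unfolding multiplicity_spectrum_def twist_exponent_eq
    using finite_zeta_support zeta_exponent_support by (intro sum.mono_neutral_left) (auto simp: T_def)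
  also have "\<dots> = (\<Sum>a\<in>T. of_int (zeta_exponent a) * 1)" by simp
  also have "\<dots> = (\<Sum>e\<in>weight_divisors. \<Sum>i<N e. of_nat (orbit_mult e) * (\<Sum>a\<in>T \<inter> zeta_roots e i. 1))"
    by (rule sum_zeta_exponent) (auto simp: T_def)
  also have "\<dots> = (\<Sum>e\<in>weight_divisors. \<Sum>i<N e. if i = j then int (totient e) else 0)"
    by (intro sum.cong refl) (auto simp: inter card_roots orbit_mult_frob_order[symmetric])
  also have "\<dots> = (\<Sum>e\<in>weight_divisors. if j < N e then int (totient e) else 0)"
    by (simp add: sum.delta)
  also have "\<dots> = (\<Sum>e | e \<in> weight_divisors \<and> j < N e. int (totient e))"
    using finite_weight_divisors by (simp add: sum.inter_filter)
  also have "{e. e \<in> weight_divisors \<and> j < N e} = {e. e \<ge> 1 \<and> \<not> p dvd e \<and> N e \<ge> j + 1}"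
    by (auto simp: weight_divisors_def)
  finally show ?thesis .
qed

end

section \<open>The last entry of the spectrum\<close>

text \<open>There are only \<open>n + 1\<close> indices, so the bound forces \<open>e\<close> to
  divide every weight.\<close>

lemma weight_count_ge_Suc_iff:
  "weight_count n w e \<ge> n + 1 \<longleftrightarrow> e dvd Gcd (w ` {..n})"
proof -
  have "weight_count n w e \<ge> n + 1 \<longleftrightarrow> {i. i \<le> n \<and> e dvd w i} = {..n}"
  proof
    assume "weight_count n w e \<ge> n + 1"
    then show "{i. i \<le> n \<and> e dvd w i} = {..n}"
      by (intro card_subset_eq) (use weight_count_le[of n w e] in \<open>auto simp: weight_count_def\<close>)
  qed (simp add: weight_count_def)
  also have "\<dots> \<longleftrightarrow> e dvd Gcd (w ` {..n})" by (auto simp: dvd_Gcd_iff)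
  finally show ?thesis .
qed

text \<open>The divisors of \<open>d\<close> prime to \<open>p\<close> are the divisors of its
  prime-to-\<open>p\<close> part, and totients over all divisors of a number sum to that
  number.\<close>

lemma sum_totient_coprime_divisors:
  assumes p: "Factorial_Ring.prime p" and d: "d > 0"
  shows "(\<Sum>e | e dvd d \<and> \<not> p dvd e. totient e) = prime_to_part p d"
proof -
  let ?m = "multiplicity p d"
  have "p ^ ?m dvd d" by (rule multiplicity_dvd)
  then have d_eq: "d = p ^ ?m * prime_to_part p d" by (simp add: prime_to_part_def)
  have np: "\<not> p dvd prime_to_part p d"
    unfolding prime_to_part_def using p d by (intro multiplicity_decompose) auto
  have "e dvd d \<and> \<not> p dvd e \<longleftrightarrow> e dvd prime_to_part p d" for e
  proof
    assume e: "e dvd d \<and> \<not> p dvd e"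
    then have "coprime e (p ^ ?m)" using prime_imp_coprime[OF p, of e] by (simp add: coprime_commute)
    then show "e dvd prime_to_part p d" using e d_eq by (metis coprime_dvd_mult_right_iff)
  next
    assume "e dvd prime_to_part p d"
    then show "e dvd d \<and> \<not> p dvd e" using np d_eq by (metis dvd_mult dvd_trans)
  qed
  then show ?thesis using totient_divisor_sum by simp
qed

theorem corollary7p5:
  fixes p n d :: nat and w :: "nat \<Rightarrow> nat" and Q :: "nat set"
  assumes "Factorial_Ring.prime p"
    and "\<And>i. i \<le> n \<Longrightarrow> w i > 0"
    and "d = Gcd (w ` {..n})"
    and "Q = {q. \<exists>k\<ge>1. q = p ^ k}"
  shows
    "(\<forall>q\<in>Q. \<forall>j\<le>n. multiplicity_spectrum n w q j =
        (\<Sum>e | e \<ge> 1 \<and> \<not> p dvd e \<and> weight_count n w e \<ge> j + 1. int (totient e)))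
     \<and> (\<forall>q\<in>Q. \<forall>q'\<in>Q. \<forall>j\<le>n.
          multiplicity_spectrum n w q j = multiplicity_spectrum n w q' j)
     \<and> (\<forall>q\<in>Q. (\<forall>j<n. multiplicity_spectrum n w q j \<ge> multiplicity_spectrum n w q (j + 1))
          \<and> multiplicity_spectrum n w q n = int (prime_to_part p d))
     \<and> (\<forall>q\<in>Q. \<forall>j\<le>n. multiplicity_spectrum n w q j \<ge> 1)
     \<and> (d = 1 \<longrightarrow> (\<forall>q\<in>Q. \<forall>j\<le>n.
          multiplicity_spectrum n w q j - 1 =
            (\<Sum>e | e \<ge> 2 \<and> \<not> p dvd e \<and> weight_count n w e \<ge> j + 1. int (totient e))
          \<and> multiplicity_spectrum n w q j - 1 \<ge> 0))"
proof -
  \<comment> \<open>These index sets do not involve \<open>q\<close>, which gives (i), and they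
    shrink as \<open>j\<close> grows, which gives the monotonicity in (ii).\<close>
  define B where "B j = {e. e \<ge> 1 \<and> \<not> p dvd e \<and> weight_count n w e \<ge> j + 1}" for j
  define s where "s j = (\<Sum>e\<in>B j. int (totient e))" for j
  have spec: "multiplicity_spectrum n w q j = s j" if "q \<in> Q" for q j
  proof -
    from that assms(4) obtain k where "k \<ge> 1" "q = p ^ k" by blast
    then interpret weighted_zeta p n q k w by unfold_locales (use assms in auto)
    show ?thesis unfolding s_def B_def by (rule multiplicity_spectrum_eq)
  qed
  have fin: "finite (B j)" for j
    by (rule finite_subset[OF _ finite_weight_count_pos[OF assms(2)]]) (auto simp: B_def)
  have mono: "s (j + 1) \<le> s j" for j
    unfolding s_def by (rule sum_mono2[OF fin]) (auto simp: B_def)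
  have "d dvd w 0" unfolding assms(3) by (rule Gcd_dvd) simp
  then have d: "d > 0" using assms(2)[of 0] by (intro gr0I) simp
  have Bn: "B n = {e. e dvd d \<and> \<not> p dvd e}"
    using d unfolding B_def weight_count_ge_Suc_iff assms(3)[symmetric]
    by (auto dest: dvd_pos_nat simp: Suc_le_eq)
  have sn: "s n = int (prime_to_part p d)"
    unfolding s_def Bn by (simp flip: sum_totient_coprime_divisors[OF assms(1) d])
  \<comment> \<open>The number 1 divides all \<open>n + 1\<close> weights, so it occurs for every
    \<open>j \<le> n\<close>, and its totient 1 accounts for the lower bound in (iii).\<close>
  have one: "1 \<in> B j" if "j \<le> n" for j
    using assms(1) that by (auto simp: B_def weight_count_def not_prime_unit)
  have split: "s j - 1 = (\<Sum>e | e \<ge> 2 \<and> \<not> p dvd e \<and> weight_count n w e \<ge> j + 1. int (totient e))"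
    if "j \<le> n" for j
  proof -
    have "s j = 1 + (\<Sum>e\<in>B j - {1}. int (totient e))"
      unfolding s_def using sum.remove[OF fin one[OF that], of "\<lambda>e. int (totient e)"] by simp
    also have "B j - {1} = {e. e \<ge> 2 \<and> \<not> p dvd e \<and> weight_count n w e \<ge> j + 1}"
      by (auto simp: B_def)
    finally show ?thesis by simp
  qed
  have nonneg: "s j - 1 \<ge> 0" if "j \<le> n" for j
    unfolding split[OF that] by (rule sum_nonneg) simp
  show ?thesis
  proof (intro conjI ballI allI impI, goal_cases)
    case (1 q j)
    then show ?case by (simp only: spec s_def B_def)
  next
    case (2 q q' j)
    then show ?case by (simp only: spec)
  next
    case (3 q j)
    then show ?case using mono by (simp only: spec)
  next
    case (4 q)
    then show ?case using sn by (simp only: spec)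
  next
    case (5 q j)
    then show ?case using nonneg[of j] by (simp add: spec)
  next
    case (6 q j)
    then show ?case using split[of j] by (simp only: spec)
  next
    case (7 q j)
    then show ?case using nonneg[of j] by (simp only: spec)
  qed
qed

end
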